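(* Let $\Gamma$ be a discrete group, $H\le\Gamma$ a commensurated subgroup, and $X$ a $\Gamma$-space which is $H$-minimal. Then there is a $\Gamma$-equivariant homeomorphism $RB_X(\Gamma,H)\cong\partial_F(H,X)$, where $\partial_F(H,X)$ is equipped with the unique $\Gamma$-action by homeomorphisms that extends its $H$-action and makes $\pi_H:\partial_F(H,X)\to X$ $\Gamma$-equivariant.
   Context: A $G$-space is a nonempty compact Hausdorff space with an action of the discrete group $G$ by homeomorphisms; it is ($G$-)minimal if every $G$-orbit is dense. A $G$-extension (factor map) is a continuous $G$-equivariant surjection. A factor map $\pi:Y\to X$ is a $G$-strongly proximal extension if for every $x\in X$ and every (regular) Borel probability measure $\nu$ on $Y$ with $\mathrm{supp}(\nu)\subset\pi^{-1}(x)$ there is $y\in Y$ with $\delta_y$ in the weak* closure of $G\nu$. A $(G,X)$-boundary is a pair $(Y,\pi_Y)$ with $Y$ a minimal $G$-space and $\pi_Y:Y\to X$ a $G$-strongly proximal extension. The generalized Furstenberg boundary $(\partial_F(G,X),\pi_G)$ is the $(G,X)$-boundary such that for every $(G,X)$-boundary $(Y,\pi_Y)$ there is a unique continuous $G$-equivariant surjection $\Phi:\partial_F(G,X)\to Y$ with $\pi_Y\circ\Phi=\pi_G$ (it exists for $X$ minimal, and is unique up to isomorphism over $X$). $H\le\Gamma$ is commensurated if $[H:H\cap gHg^{-1}]<\infty$ for all $g\in\Gamma$. In this case, for $X$ an $H$-minimal $\Gamma$-space, there is a unique $\Gamma$-action by homeomorphisms on $\partial_F(H,X)$ extending the $H$-action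 for which $\pi_H$ is $\Gamma$-equivariant. $\pi_{RB}:RB_X(\Gamma,H)\to X$ denotes the universal object of the class $\mathcal C$ of all $\Gamma$-extensions $\pi:Y\to X$ with $Y$ $\Gamma$-minimal and $\pi$ an $H$-strongly proximal extension: it belongs to $\mathcal C$, and for every $\pi:Y\to X$ in $\mathcal C$ there is a continuous $\Gamma$-equivariant $f:RB_X(\Gamma,H)\to Y$ with $\pi\circ f=\pi_{RB}$ (such an object exists when $X$ is $H$-minimal). *)

theory Defs
  imports "HOL-Algebra.Group_Action" "HOL-Probability.Giry_Monad"
begin

text \<open>
  Spaces are abstract topologies (with carrier \<open>topspace\<close>), so that a space may be a proper
  subset of the ambient type. Acting groups are discrete and carry no topology; the restriction
  of an action to a subgroup \<open>H\<close> of \<open>G\<close> is the same map, regarded as an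
  action of \<open>G\<lparr>carrier := H\<rparr>\<close>.
\<close>

definition commensurated :: "('g, 'm) monoid_scheme \<Rightarrow> 'g set \<Rightarrow> bool" where
  "commensurated G H \<longleftrightarrow> subgroup H G \<and>
     (\<forall>g \<in> carrier G.
        finite (rcosets\<^bsub>G\<lparr>carrier := H\<rparr>\<^esub> (H \<inter> (g <#\<^bsub>G\<^esub> H #>\<^bsub>G\<^esub> (inv\<^bsub>G\<^esub> g)))))"


section \<open>Spaces with a group action and their extensions\<close>

definition G_space ::
    "('g, 'm) monoid_scheme \<Rightarrow> 'y topology \<Rightarrow> ('g \<Rightarrow> 'y \<Rightarrow> 'y) \<Rightarrow> bool" where
  "G_space G Y \<alpha> \<longleftrightarrow>
     topspace Y \<noteq> {} \<and> compact_space Y \<and> Hausdorff_space Y \<and>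
     group_action G (topspace Y) \<alpha> \<and>
     (\<forall>g \<in> carrier G. homeomorphic_map Y Y (\<alpha> g))"

definition minimal_G_space ::
    "('g, 'm) monoid_scheme \<Rightarrow> 'y topology \<Rightarrow> ('g \<Rightarrow> 'y \<Rightarrow> 'y) \<Rightarrow> bool" where
  "minimal_G_space G Y \<alpha> \<longleftrightarrow> G_space G Y \<alpha> \<and>
     (\<forall>y \<in> topspace Y. Y closure_of (orbit G \<alpha> y) = topspace Y)"

definition equivariant ::
    "('g, 'm) monoid_scheme \<Rightarrow> 'y topology \<Rightarrow> ('g \<Rightarrow> 'y \<Rightarrow> 'y) \<Rightarrow> ('g \<Rightarrow> 'z \<Rightarrow> 'z) \<Rightarrow>
     ('y \<Rightarrow> 'z) \<Rightarrow> bool" where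
  "equivariant G Y \<alpha> \<beta> f \<longleftrightarrow>
     (\<forall>g \<in> carrier G. \<forall>y \<in> topspace Y. f (\<alpha> g y) = \<beta> g (f y))"

definition G_extension ::
    "('g, 'm) monoid_scheme \<Rightarrow> 'y topology \<Rightarrow> ('g \<Rightarrow> 'y \<Rightarrow> 'y) \<Rightarrow>
     'x topology \<Rightarrow> ('g \<Rightarrow> 'x \<Rightarrow> 'x) \<Rightarrow> ('y \<Rightarrow> 'x) \<Rightarrow> bool" where
  "G_extension G Y \<alpha> X \<xi> \<pi> \<longleftrightarrow>
     G_space G Y \<alpha> \<and> G_space G X \<xi> \<and>
     continuous_map Y X \<pi> \<and> \<pi> ` topspace Y = topspace X \<and> equivariant G Y \<alpha> \<xi> \<pi>"


section \<open>Regular Borel probability measures and the weak* topology\<close>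

definition borel_of :: "'y topology \<Rightarrow> 'y measure" where
  "borel_of Y = sigma (topspace Y) {U. openin Y U}"

definition regular_prob_measures :: "'y topology \<Rightarrow> 'y measure set" where
  "regular_prob_measures Y =
     {\<nu>. prob_space \<nu> \<and> sets \<nu> = sets (borel_of Y) \<and>
        (\<forall>A \<in> sets \<nu>.
           emeasure \<nu> A = (SUP K \<in> {K. compactin Y K \<and> K \<in> sets \<nu> \<and> K \<subseteq> A}. emeasure \<nu> K) \<and>
           emeasure \<nu> A = (INF U \<in> {U. openin Y U \<and> A \<subseteq> U}. emeasure \<nu> U))}"

definition measure_support :: "'y topology \<Rightarrow> 'y measure \<Rightarrow> 'y set" where
  "measure_support Y \<nu> =
     {y \<in> topspace Y. \<forall>U. openin Y U \<and> y \<in> U \<longrightarrow> emeasure \<nu> U > 0}"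

text \<open>
  The weak* topology: the coarsest topology on the regular Borel probability measures for which
  integration against each continuous function is continuous.
\<close>

definition weak_star_topology :: "'y topology \<Rightarrow> 'y measure topology" where
  "weak_star_topology Y = topology_generated_by
     {{\<nu> \<in> regular_prob_measures Y. (\<integral>y. f y \<partial>\<nu>) \<in> U} | f U.
        continuous_map Y euclideanreal f \<and> open U}"

definition strongly_proximal_extension ::
    "('g, 'm) monoid_scheme \<Rightarrow> 'y topology \<Rightarrow> ('g \<Rightarrow> 'y \<Rightarrow> 'y) \<Rightarrow>
     'x topology \<Rightarrow> ('g \<Rightarrow> 'x \<Rightarrow> 'x) \<Rightarrow> ('y \<Rightarrow> 'x) \<Rightarrow> bool" where
  "strongly_proximal_extension G Y \<alpha> X \<xi> \<pi> \<longleftrightarrow>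
     G_extension G Y \<alpha> X \<xi> \<pi> \<and>
     (\<forall>x \<in> topspace X. \<forall>\<nu> \<in> regular_prob_measures Y.
        measure_support Y \<nu> \<subseteq> {y \<in> topspace Y. \<pi> y = x} \<longrightarrow>
        (\<exists>y \<in> topspace Y.
           return (borel_of Y) y \<in>
             weak_star_topology Y closure_of {distr \<nu> (borel_of Y) (\<alpha> g) | g. g \<in> carrier G}))"


section \<open>Universal objects\<close>

definition relative_boundary ::
    "('g, 'm) monoid_scheme \<Rightarrow> 'x topology \<Rightarrow> ('g \<Rightarrow> 'x \<Rightarrow> 'x) \<Rightarrow>
     'y topology \<Rightarrow> ('g \<Rightarrow> 'y \<Rightarrow> 'y) \<Rightarrow> ('y \<Rightarrow> 'x) \<Rightarrow> bool" where
  "relative_boundary G X \<xi> Y \<alpha> \<pi> \<longleftrightarrow>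
     minimal_G_space G Y \<alpha> \<and> strongly_proximal_extension G Y \<alpha> X \<xi> \<pi>"

text \<open>
  In both universal properties below, the competing spaces are all spaces carried by subsets of the
  type \<open>'u\<close> of the universal object, since HOL cannot quantify over types inside a formula.
  A minimal space of a group of type \<open>'g\<close> is Hausdorff with a dense orbit, so it has a copy
  on a subset of \<open>'g set set\<close>; hence for \<open>'u = 'g set set\<close>, or any larger type,
  these are the unrestricted universal properties. Maps are taken extensional to make unique existence
  refer to their values on the space only.
\<close>

definition furstenberg_boundary ::
    "('g, 'm) monoid_scheme \<Rightarrow> 'x topology \<Rightarrow> ('g \<Rightarrow> 'x \<Rightarrow> 'x) \<Rightarrow>
     'u topology \<Rightarrow> ('g \<Rightarrow> 'u \<Rightarrow> 'u) \<Rightarrow> ('u \<Rightarrow> 'x) \<Rightarrow> bool" where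
  "furstenberg_boundary G X \<xi> B \<beta> \<pi>B \<longleftrightarrow>
     relative_boundary G X \<xi> B \<beta> \<pi>B \<and>
     (\<forall>(Y :: 'u topology) \<alpha> \<pi>. relative_boundary G X \<xi> Y \<alpha> \<pi> \<longrightarrow>
        (\<exists>!\<Phi>. \<Phi> \<in> extensional (topspace B) \<and>
              continuous_map B Y \<Phi> \<and> \<Phi> ` topspace B = topspace Y \<and> equivariant G B \<beta> \<alpha> \<Phi> \<and>
              (\<forall>b \<in> topspace B. \<pi> (\<Phi> b) = \<pi>B b)))"

definition RB_class ::
    "('g, 'm) monoid_scheme \<Rightarrow> 'g set \<Rightarrow> 'x topology \<Rightarrow> ('g \<Rightarrow> 'x \<Rightarrow> 'x) \<Rightarrow>
     'y topology \<Rightarrow> ('g \<Rightarrow> 'y \<Rightarrow> 'y) \<Rightarrow> ('y \<Rightarrow> 'x) \<Rightarrow> bool" where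
  "RB_class G H X \<xi> Y \<alpha> \<pi> \<longleftrightarrow>
     G_extension G Y \<alpha> X \<xi> \<pi> \<and> minimal_G_space G Y \<alpha> \<and>
     strongly_proximal_extension (G\<lparr>carrier := H\<rparr>) Y \<alpha> X \<xi> \<pi>"

definition RB_universal ::
    "('g, 'm) monoid_scheme \<Rightarrow> 'g set \<Rightarrow> 'x topology \<Rightarrow> ('g \<Rightarrow> 'x \<Rightarrow> 'x) \<Rightarrow>
     'u topology \<Rightarrow> ('g \<Rightarrow> 'u \<Rightarrow> 'u) \<Rightarrow> ('u \<Rightarrow> 'x) \<Rightarrow> bool" where
  "RB_universal G H X \<xi> R \<rho> \<pi>R \<longleftrightarrow>
     RB_class G H X \<xi> R \<rho> \<pi>R \<and>
     (\<forall>(Y :: 'u topology) \<alpha> \<pi>. RB_class G H X \<xi> Y \<alpha> \<pi> \<longrightarrow>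
        (\<exists>f. continuous_map R Y f \<and> equivariant G R \<rho> \<alpha> f \<and>
             (\<forall>r \<in> topspace R. \<pi> (f r) = \<pi>R r)))"

text \<open>
  An action of \<open>G\<close> on an \<open>H\<close>-space over \<open>X\<close> that extends the given
  action \<open>\<theta>\<close> of \<open>H\<close> and makes the projection equivariant. When \<open>H\<close> is
  commensurated in \<open>G\<close> and the space is the Furstenberg boundary of \<open>H\<close> relative
  to an \<open>H\<close>-minimal \<open>X\<close>, there is at most one such action.
\<close>

definition extends_action_over ::
    "('g, 'm) monoid_scheme \<Rightarrow> 'g set \<Rightarrow> ('g \<Rightarrow> 'x \<Rightarrow> 'x) \<Rightarrow>
     'u topology \<Rightarrow> ('g \<Rightarrow> 'u \<Rightarrow> 'u) \<Rightarrow> ('u \<Rightarrow> 'x) \<Rightarrow> ('g \<Rightarrow> 'u \<Rightarrow> 'u) \<Rightarrow> bool" where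
  "extends_action_over G H \<xi> B \<theta> \<pi>B \<beta> \<longleftrightarrow>
     G_space G B \<beta> \<and> (\<forall>h \<in> H. \<forall>b \<in> topspace B. \<beta> h b = \<theta> h b) \<and>
     equivariant G B \<beta> \<xi> \<pi>B"

end

theory Submission
  imports Defs
begin

text \<open>
  The point is that every \<open>Y\<close> in the class defining \<open>RB\<close> is already \<open>H\<close>-minimal. If a finite
  family of closed sets is permuted by \<open>H\<close> and each of its members meets the fibre over \<open>x\<close>, pick
  one point over \<open>x\<close> in each member and let \<open>\<nu>\<close> be the uniform measure on these points: every
  translate \<open>h\<nu>\<close> gives each member mass bounded below, so the point \<open>y\<close> with \<open>\<delta>\<^sub>y\<close> in the closure
  of \<open>H\<nu>\<close> lies in all members. For \<open>Z\<close> closed, nonempty and \<open>H\<close>-invariant, commensuration makes the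
  \<open>H\<close>-orbit of each translate \<open>gZ\<close> finite, so the translates \<open>gZ\<close>, over all \<open>g\<close> and \<open>Z\<close>, have the
  finite intersection property. Their intersection is nonempty, closed and \<open>\<Gamma>\<close>-invariant, hence
  all of \<open>Y\<close>, and every such \<open>Z\<close> is \<open>Y\<close>. Therefore \<open>RB\<close> is an \<open>(H,X)\<close>-boundary, and the two
  universal properties give mutually inverse maps.
\<close>

section \<open>Finitely supported measures\<close>

lemma space_borel_of [simp]: "space (borel_of Y) = topspace Y"
  by (simp add: borel_of_def space_measure_of_conv)

lemma sets_borel_of: "sets (borel_of Y) = sigma_sets (topspace Y) {U. openin Y U}"
  unfolding borel_of_def by (rule sets_measure_of) (auto dest: openin_subset)

lemma openin_sets_borel_of: "openin Y U \<Longrightarrow> U \<in> sets (borel_of Y)"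
  by (auto simp: sets_borel_of)

lemma closedin_sets_borel_of:
  assumes "closedin Y C" shows "C \<in> sets (borel_of Y)"
proof -
  have "topspace Y - (topspace Y - C) \<in> sets (borel_of Y)"
    using openin_sets_borel_of[of Y "topspace Y - C"] assms sets.compl_sets[of _ "borel_of Y"]
    by (metis closedin_def space_borel_of)
  with closedin_subset[OF assms] show ?thesis
    by (simp add: double_diff)
qed

lemma continuous_map_measurable_borel_of:
  assumes "continuous_map Y Z f" shows "f \<in> measurable (borel_of Y) (borel_of Z)"
proof (rule measurable_sigma_sets[OF sets_borel_of])
  show "{U. openin Z U} \<subseteq> Pow (topspace Z)" by (auto dest: openin_subset)
  show "f \<in> space (borel_of Y) \<rightarrow> topspace Z"
    using continuous_map_funspace[OF assms] by simp
  fix U assume "U \<in> {U. openin Z U}"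
  then have "openin Y {x \<in> topspace Y. f x \<in> U}"
    using assms by (simp add: openin_continuous_map_preimage)
  moreover have "{x \<in> topspace Y. f x \<in> U} = f -` U \<inter> space (borel_of Y)" by auto
  ultimately show "f -` U \<inter> space (borel_of Y) \<in> sets (borel_of Y)"
    using openin_sets_borel_of by metis
qed

lemma continuous_map_borel_measurable:
  fixes f :: "'a \<Rightarrow> real"
  assumes "continuous_map Y euclideanreal f" shows "f \<in> borel_measurable (borel_of Y)"
proof (rule borel_measurableI)
  fix S :: "real set" assume "open S"
  then have "openin Y {x \<in> topspace Y. f x \<in> S}"
    using assms by (intro openin_continuous_map_preimage) auto
  moreover have "{x \<in> topspace Y. f x \<in> S} = f -` S \<inter> space (borel_of Y)" by auto
  ultimately show "f -` S \<inter> space (borel_of Y) \<in> sets (borel_of Y)"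
    using openin_sets_borel_of by metis
qed

text \<open>\<open>uniform_count_measure F\<close> lives on the power set of \<open>F\<close>;
  pushing it along the identity turns it into a Borel measure on all of \<open>Y\<close>, with an
  atom of mass \<open>1 / card F\<close> at each point of \<open>F\<close>.\<close>

definition uniform_on :: "'y topology \<Rightarrow> 'y set \<Rightarrow> 'y measure" where
  "uniform_on Y F = distr (uniform_count_measure F) (borel_of Y) (\<lambda>x. x)"

context
  fixes Y :: "'y topology" and F :: "'y set"
  assumes F: "finite F" "F \<noteq> {}" "F \<subseteq> topspace Y"
begin

lemma id_measurable_uniform_count_measure:
  "(\<lambda>x. x) \<in> measurable (uniform_count_measure F) (borel_of Y)"
  using F by (auto simp: measurable_def space_uniform_count_measure sets_uniform_count_measure)

lemma sets_uniform_on: "sets (uniform_on Y F) = sets (borel_of Y)"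
  by (simp add: uniform_on_def)

lemma emeasure_uniform_on:
  assumes "A \<in> sets (borel_of Y)"
  shows "emeasure (uniform_on Y F) A = card (A \<inter> F) / card F"
proof -
  have "emeasure (uniform_on Y F) A = emeasure (uniform_count_measure F) (A \<inter> F)"
    by (simp add: uniform_on_def emeasure_distr[OF id_measurable_uniform_count_measure assms]
        space_uniform_count_measure)
  also have "\<dots> = card (A \<inter> F) / card F"
    by (rule emeasure_uniform_count_measure) (use F in auto)
  finally show ?thesis .
qed

lemma integral_uniform_on:
  fixes f :: "'y \<Rightarrow> real"
  assumes "f \<in> borel_measurable (borel_of Y)"
  shows "(\<integral>y. f y \<partial>uniform_on Y F) = sum f F / card F"
  unfolding uniform_on_def
  by (subst integral_distr[OF id_measurable_uniform_count_measure assms])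
    (simp add: integral_uniform_count_measure F)

text \<open>Both approximations are attained: subsets of \<open>F\<close> are compact and closed, so
  \<open>A \<inter> F\<close> serves from inside and the complement of \<open>F - A\<close> from
  outside.\<close>

lemma uniform_on_regular:
  assumes "Hausdorff_space Y"
  shows "uniform_on Y F \<in> regular_prob_measures Y"
proof -
  let ?\<nu> = "uniform_on Y F"
  have fin: "closedin Y S" "compactin Y S" if "S \<subseteq> F" for S
    using that F assms
    by (meson closedin_Hausdorff_finite finite_subset subset_trans)
      (meson that F finite_subset finite_imp_compactin subset_trans)
  have "prob_space ?\<nu>"
    unfolding uniform_on_def
    by (intro prob_space.prob_space_distr prob_space_uniform_count_measure F
        id_measurable_uniform_count_measure)
  moreover have "emeasure ?\<nu> A =
      (SUP K \<in> {K. compactin Y K \<and> K \<in> sets ?\<nu> \<and> K \<subseteq> A}. emeasure ?\<nu> K)"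
    if A: "A \<in> sets ?\<nu>" for A
  proof (rule antisym)
    have AF: "A \<inter> F \<in> sets (borel_of Y)"
      by (simp add: closedin_sets_borel_of fin)
    have "emeasure ?\<nu> A = emeasure ?\<nu> (A \<inter> F)"
      using A AF by (simp add: emeasure_uniform_on sets_uniform_on Int_assoc)
    also have "\<dots> \<le> (SUP K \<in> {K. compactin Y K \<and> K \<in> sets ?\<nu> \<and> K \<subseteq> A}. emeasure ?\<nu> K)"
      by (rule SUP_upper) (auto simp: fin AF sets_uniform_on)
    finally show "emeasure ?\<nu> A \<le> \<dots>" .
    show "(SUP K \<in> {K. compactin Y K \<and> K \<in> sets ?\<nu> \<and> K \<subseteq> A}. emeasure ?\<nu> K) \<le> emeasure ?\<nu> A"
      using A by (auto intro!: SUP_least emeasure_mono)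
  qed
  moreover have "emeasure ?\<nu> A = (INF U \<in> {U. openin Y U \<and> A \<subseteq> U}. emeasure ?\<nu> U)"
    if A: "A \<in> sets ?\<nu>" for A
  proof (rule antisym)
    let ?U = "topspace Y - (F - A)"
    have sub: "A \<subseteq> topspace Y"
      using sets.sets_into_space[of A "borel_of Y"] A by (simp add: sets_uniform_on)
    have U: "openin Y ?U"
      by (simp add: fin openin_diff)
    have "?U \<inter> F = A \<inter> F" using F sub by auto
    then have "emeasure ?\<nu> ?U = emeasure ?\<nu> A"
      using A openin_sets_borel_of[OF U] by (simp add: emeasure_uniform_on sets_uniform_on)
    moreover have "(INF U \<in> {U. openin Y U \<and> A \<subseteq> U}. emeasure ?\<nu> U) \<le> emeasure ?\<nu> ?U"
      by (rule INF_lower) (use U sub in auto)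
    ultimately show "(INF U \<in> {U. openin Y U \<and> A \<subseteq> U}. emeasure ?\<nu> U) \<le> emeasure ?\<nu> A"
      by simp
    show "emeasure ?\<nu> A \<le> (INF U \<in> {U. openin Y U \<and> A \<subseteq> U}. emeasure ?\<nu> U)"
      using openin_sets_borel_of
      by (auto intro!: INF_greatest emeasure_mono simp: sets_uniform_on)
  qed
  ultimately show ?thesis
    unfolding regular_prob_measures_def using sets_uniform_on by blast
qed

text \<open>The complement of \<open>F\<close> is an open null set. Hence the support lies in a
  fibre as soon as \<open>F\<close> does.\<close>

lemma measure_support_uniform_on:
  assumes "Hausdorff_space Y"
  shows "measure_support Y (uniform_on Y F) \<subseteq> F"
proof
  fix y assume y: "y \<in> measure_support Y (uniform_on Y F)"
  have U: "openin Y (topspace Y - F)"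
    using F assms by (simp add: closedin_Hausdorff_finite openin_diff)
  moreover have "emeasure (uniform_on Y F) (topspace Y - F) = 0"
    using openin_sets_borel_of[OF U] by (simp add: emeasure_uniform_on Int_commute)
  ultimately show "y \<in> F"
    using y by (force simp: measure_support_def)
qed

end

text \<open>The condition that the integral of \<open>f\<close> is below \<open>c\<close> defines a
  subbasic open set containing the point mass at \<open>y\<close>, so \<open>S\<close> meets it. The
  closure condition is thereby reduced to one inequality for one test function.\<close>

lemma weak_star_closure_return_less:
  fixes f :: "'y \<Rightarrow> real"
  assumes y: "return (borel_of Y) y \<in> weak_star_topology Y closure_of S" "y \<in> topspace Y"
    and f: "continuous_map Y euclideanreal f" "f y < c"
  obtains \<mu> where "\<mu> \<in> S" "(\<integral>y. f y \<partial>\<mu>) < c"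
proof -
  let ?W = "{\<mu> \<in> regular_prob_measures Y. (\<integral>y. f y \<partial>\<mu>) \<in> {..<c}}"
  have W: "openin (weak_star_topology Y) ?W"
    unfolding weak_star_topology_def
  proof (rule topology_generated_by_Basis, unfold mem_Collect_eq, intro exI conjI)
    show "?W = ?W" ..
  qed (simp_all add: f)
  \<comment> \<open>Regularity of the point mass is read off from its membership in a closure, since
    all points of this topology are regular measures.\<close>
  have "topspace (weak_star_topology Y) \<subseteq> regular_prob_measures Y"
    unfolding weak_star_topology_def topology_generated_by_topspace
    by (rule Union_least) auto
  then have "return (borel_of Y) y \<in> regular_prob_measures Y"
    using y(1) closure_of_subset_topspace by (metis subsetD)
  moreover have "(\<integral>y. f y \<partial>return (borel_of Y) y) = f y"
    using y(2) continuous_map_borel_measurable[OF f(1)] by (intro integral_return) auto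
  ultimately have "return (borel_of Y) y \<in> ?W"
    using f by auto
  moreover have "\<exists>\<mu>. \<mu> \<in> S \<and> \<mu> \<in> T"
    if "return (borel_of Y) y \<in> T" "openin (weak_star_topology Y) T" for T
    using y(1) that by (simp add: in_closure_of)
  ultimately obtain \<mu> where "\<mu> \<in> S" "\<mu> \<in> ?W" using W by metis
  with that show thesis by simp
qed


section \<open>Strong proximality and minimality\<close>

lemma G_space_continuous: "G_space G Y \<alpha> \<Longrightarrow> g \<in> carrier G \<Longrightarrow> continuous_map Y Y (\<alpha> g)"
  by (simp add: G_space_def homeomorphic_imp_continuous_map)

lemma G_space_action: "G_space G Y \<alpha> \<Longrightarrow> group_action G (topspace Y) \<alpha>"
  by (simp add: G_space_def)

lemma G_space_closedin:
  assumes "G_space G Y \<alpha>" "g \<in> carrier G" "closedin Y Z"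
  shows "closedin Y (\<alpha> g ` Z)"
  using assms unfolding G_space_def
  by (meson closedin_subset homeomorphic_map_closedness)

lemma G_space_mult_image:
  assumes "G_space G Y \<alpha>" "g \<in> carrier G" "h \<in> carrier G" "Z \<subseteq> topspace Y"
  shows "\<alpha> g ` \<alpha> h ` Z = \<alpha> (g \<otimes>\<^bsub>G\<^esub> h) ` Z"
  using group_action.composition_rule[OF G_space_action[OF assms(1)] _ assms(2,3)] assms(4)
  by (force simp: image_image subset_iff)

lemma G_space_one_image:
  assumes "G_space G Y \<alpha>" "Z \<subseteq> topspace Y"
  shows "\<alpha> \<one>\<^bsub>G\<^esub> ` Z = Z"
  using group_action.id_eq_one[OF G_space_action[OF assms(1)], symmetric] assms(2) by auto

lemma G_space_group: "G_space G Y \<alpha> \<Longrightarrow> group G"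
  using G_space_action group_action.group_hom group_hom.axioms(1) by blast

text \<open>Applying \<open>g\<close> to the inclusion for the inverse of \<open>g\<close> gives the
  reverse inclusion.\<close>

lemma G_space_invariant_image_eq:
  assumes Y: "G_space G Y \<alpha>" and Z: "Z \<subseteq> topspace Y" "\<And>g. g \<in> carrier G \<Longrightarrow> \<alpha> g ` Z \<subseteq> Z"
    and g: "g \<in> carrier G"
  shows "\<alpha> g ` Z = Z"
proof -
  interpret group G using Y by (rule G_space_group)
  have "Z = \<alpha> g ` \<alpha> (inv\<^bsub>G\<^esub> g) ` Z"
    using Y Z g by (simp add: G_space_mult_image G_space_one_image)
  also have "\<dots> \<subseteq> \<alpha> g ` Z" using Z(2)[of "inv\<^bsub>G\<^esub> g"] g by auto
  finally show ?thesis using Z(2)[OF g] by auto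
qed

lemma G_space_subgroup:
  assumes "G_space G Y \<alpha>" "subgroup H G"
  shows "G_space (G\<lparr>carrier := H\<rparr>) Y \<alpha>"
  using assms group_action.induced_action subgroup.subset unfolding G_space_def by fastforce

section \<open>Minimality in terms of closed nonempty invariant subsets\<close>

lemma minimal_G_spaceD:
  assumes "minimal_G_space G Y \<alpha>" "closedin Y Z" "Z \<noteq> {}" "\<And>g. g \<in> carrier G \<Longrightarrow> \<alpha> g ` Z \<subseteq> Z"
  shows "Z = topspace Y"
proof -
  obtain z where z: "z \<in> Z" "z \<in> topspace Y"
    using assms(2,3) closedin_subset by fastforce
  then have "orbit G \<alpha> z \<subseteq> Z"
    using assms(4) by (auto simp: orbit_def)
  then have "Y closure_of orbit G \<alpha> z \<subseteq> Z"
    using assms(2) by (rule closure_of_minimal)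
  then show ?thesis
    using z assms(1,2) closedin_subset by (fastforce simp: minimal_G_space_def)
qed

text \<open>Orbit closures are themselves closed, nonempty and invariant, because each
  \<open>\<alpha> g\<close> is continuous and maps the orbit into itself.\<close>

lemma minimal_G_spaceI:
  assumes Y: "G_space G Y \<alpha>"
    and min: "\<And>Z. closedin Y Z \<Longrightarrow> Z \<noteq> {} \<Longrightarrow> (\<And>g. g \<in> carrier G \<Longrightarrow> \<alpha> g ` Z \<subseteq> Z) \<Longrightarrow>
      Z = topspace Y"
  shows "minimal_G_space G Y \<alpha>"
  unfolding minimal_G_space_def
proof (intro conjI ballI Y)
  fix y assume y: "y \<in> topspace Y"
  interpret group_action G "topspace Y" \<alpha> using Y by (rule G_space_action)
  interpret group G using Y by (rule G_space_group)
  have orb: "orbit G \<alpha> y \<subseteq> topspace Y"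
    using y element_image by (auto simp: orbit_def)
  show "Y closure_of orbit G \<alpha> y = topspace Y"
  proof (rule min)
    show "Y closure_of orbit G \<alpha> y \<noteq> {}"
      using orbit_refl[OF y] closure_of_subset[OF orb] by auto
    fix g assume g: "g \<in> carrier G"
    have "\<alpha> g ` (Y closure_of orbit G \<alpha> y) \<subseteq> Y closure_of (\<alpha> g ` orbit G \<alpha> y)"
      using G_space_continuous[OF Y g] by (simp add: continuous_map_image_closure_subset)
    also have "\<alpha> g ` orbit G \<alpha> y \<subseteq> orbit G \<alpha> y"
      using g y composition_rule[OF y g, symmetric] by (auto simp: orbit_def)
    then have "Y closure_of (\<alpha> g ` orbit G \<alpha> y) \<subseteq> Y closure_of orbit G \<alpha> y"
      by (rule closure_of_mono)
    finally show "\<alpha> g ` (Y closure_of orbit G \<alpha> y) \<subseteq> Y closure_of orbit G \<alpha> y" .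
  qed simp
qed

lemma minimal_G_space_supergroup:
  assumes "minimal_G_space (G\<lparr>carrier := H\<rparr>) Y \<alpha>" "G_space G Y \<alpha>" "H \<subseteq> carrier G"
  shows "minimal_G_space G Y \<alpha>"
proof (rule minimal_G_spaceI[OF assms(2)])
  fix Z assume "closedin Y Z" "Z \<noteq> {}" "\<And>g. g \<in> carrier G \<Longrightarrow> \<alpha> g ` Z \<subseteq> Z"
  then show "Z = topspace Y"
    using assms(3) by (intro minimal_G_spaceD[OF assms(1)]) auto
qed

text \<open>A continuous map from a compact space to a Hausdorff space is closed, so the image of
  \<open>Z\<close> is again closed, nonempty and invariant.\<close>

lemma equivariant_image_minimal:
  assumes Y: "G_space G Y \<alpha>" and X: "minimal_G_space G X \<xi>"
    and \<pi>: "continuous_map Y X \<pi>" "equivariant G Y \<alpha> \<xi> \<pi>"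
    and Z: "closedin Y Z" "Z \<noteq> {}" "\<And>g. g \<in> carrier G \<Longrightarrow> \<alpha> g ` Z \<subseteq> Z"
  shows "\<pi> ` Z = topspace X"
proof (rule minimal_G_spaceD[OF X])
  have "closed_map Y X \<pi>"
    using Y X \<pi> by (intro continuous_imp_closed_map) (auto simp: G_space_def minimal_G_space_def)
  then show "closedin X (\<pi> ` Z)"
    using Z(1) by (simp add: closed_map_def)
  show "\<pi> ` Z \<noteq> {}" using Z by simp
  fix g assume "g \<in> carrier G"
  then have "\<xi> g (\<pi> z) = \<pi> (\<alpha> g z) \<and> \<alpha> g z \<in> Z" if "z \<in> Z" for z
    using that \<pi>(2) Z closedin_subset by (fastforce simp: equivariant_def)
  then show "\<xi> g ` \<pi> ` Z \<subseteq> \<pi> ` Z" by auto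
qed

text \<open>The weak* topology tests only continuous functions, so a member \<open>C\<close> missing
  \<open>y\<close> is detected by a Urysohn function that is 0 at \<open>y\<close> and 1 on
  \<open>C\<close>. Its integral would fall below the mass of one atom for some translate of the
  measure, yet every translate keeps an atom in \<open>C\<close>.\<close>

lemma strongly_proximal_Inter_nonempty:
  assumes sp: "strongly_proximal_extension G Y \<alpha> X \<xi> \<pi>"
    and x: "x \<in> topspace X"
    and fin: "finite \<C>" "\<C> \<noteq> {}"
    and cl: "\<And>C. C \<in> \<C> \<Longrightarrow> closedin Y C"
    and fib: "\<And>C. C \<in> \<C> \<Longrightarrow> \<exists>c \<in> C. \<pi> c = x"
    and perm: "\<And>g C. g \<in> carrier G \<Longrightarrow> C \<in> \<C> \<Longrightarrow> \<alpha> g ` C \<in> \<C>"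
  shows "\<Inter>\<C> \<noteq> {}"
proof -
  have Y: "G_space G Y \<alpha>"
    using sp by (simp add: strongly_proximal_extension_def G_extension_def)
  then have Haus: "Hausdorff_space Y" and norm: "normal_space Y"
    by (auto simp: G_space_def compact_Hausdorff_or_regular_imp_normal_space)
  interpret group G using Y by (rule G_space_group)
  obtain c where c: "\<And>C. C \<in> \<C> \<Longrightarrow> c C \<in> C \<and> \<pi> (c C) = x"
    using fib by metis
  define F where "F = c ` \<C>"
  have F: "finite F" "F \<noteq> {}" "F \<subseteq> topspace Y"
    using fin c cl closedin_subset by (fastforce simp: F_def)+
  let ?\<nu> = "uniform_on Y F"
  have supp: "measure_support Y ?\<nu> \<subseteq> {y \<in> topspace Y. \<pi> y = x}"
    using measure_support_uniform_on[OF F Haus] F c by (auto simp: F_def)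
  obtain y where y: "y \<in> topspace Y"
    "return (borel_of Y) y \<in> weak_star_topology Y closure_of
       {distr ?\<nu> (borel_of Y) (\<alpha> g) | g. g \<in> carrier G}"
    using sp x uniform_on_regular[OF F Haus] supp
    unfolding strongly_proximal_extension_def by blast
  have "y \<in> C" if C: "C \<in> \<C>" for C
  proof (rule ccontr)
    assume "y \<notin> C"
    then obtain f where f: "continuous_map Y (top_of_set {0..1}) f"
        "f ` {y} \<subseteq> {0 :: real}" "f ` C \<subseteq> {1}"
      using norm cl[OF C] y(1) Haus unfolding normal_space_iff_Urysohn
      by (metis closedin_Hausdorff_sing_eq disjnt_insert1 disjnt_empty1)
    have fr: "continuous_map Y euclideanreal f" and f01: "\<And>z. z \<in> topspace Y \<Longrightarrow> f z \<in> {0..1}"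
      using f(1) by (auto simp: continuous_map_in_subtopology)
    \<comment> \<open>The threshold is the mass of one atom. It uses \<open>card F\<close>, since
      different members may share their chosen point.\<close>
    have "f y < 1 / card F"
      using f F by (simp add: card_gt_0_iff)
    from weak_star_closure_return_less[OF y(2,1) fr this]
    obtain g where g: "g \<in> carrier G"
      and small: "(\<integral>z. f z \<partial>distr ?\<nu> (borel_of Y) (\<alpha> g)) < 1 / card F"
      by blast
    have \<alpha>: "continuous_map Y Y (\<alpha> g)" using Y g by (rule G_space_continuous)
    then have meas: "(\<lambda>z. f (\<alpha> g z)) \<in> borel_measurable (borel_of Y)"
      using continuous_map_compose[OF \<alpha> fr]
      by (intro continuous_map_borel_measurable) (simp add: o_def)
    have "\<alpha> g \<in> measurable ?\<nu> (borel_of Y)"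
      using continuous_map_measurable_borel_of[OF \<alpha>]
      by (simp cong: measurable_cong_sets add: sets_uniform_on[OF F])
    then have "(\<integral>z. f z \<partial>distr ?\<nu> (borel_of Y) (\<alpha> g)) = (\<integral>z. f (\<alpha> g z) \<partial>?\<nu>)"
      by (rule integral_distr) (rule continuous_map_borel_measurable[OF fr])
    also have "\<dots> = (\<Sum>z\<in>F. f (\<alpha> g z)) / card F"
      by (rule integral_uniform_on[OF F meas])
    finally have "(\<Sum>z\<in>F. f (\<alpha> g z)) < 1"
      using small F by (simp add: divide_less_cancel card_gt_0_iff)
    moreover have "1 \<le> (\<Sum>z\<in>F. f (\<alpha> g z))"
    proof -
      \<comment> \<open>\<open>D\<close> is the member that \<open>g\<close> carries onto
        \<open>C\<close>. Its chosen point moves into \<open>C\<close> and contributes a summand 1;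
        the other summands are nonnegative.\<close>
      define D where "D = \<alpha> (inv\<^bsub>G\<^esub> g) ` C"
      have D: "D \<in> \<C>" using perm g C by (simp add: D_def)
      have "\<alpha> g ` D = C"
        using Y g closedin_subset[OF cl[OF C]]
        by (simp add: D_def G_space_mult_image G_space_one_image)
      then have "\<alpha> g (c D) \<in> C" using c[OF D] by auto
      then have "f (\<alpha> g (c D)) = 1" using f(3) by auto
      moreover have "f (\<alpha> g (c D)) \<le> (\<Sum>z\<in>F. f (\<alpha> g z))"
        using F D f01 continuous_map_funspace[OF \<alpha>]
        by (intro member_le_sum) (auto simp: F_def Pi_iff subset_iff)
      ultimately show ?thesis by simp
    qed
    ultimately show False by simp
  qed
  then show ?thesis by auto
qed


section \<open>Commensurated subgroups\<close>

text \<open>The group \<open>K\<close>, the intersection of \<open>H\<close> with its conjugate by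
  \<open>g\<close>, stabilizes \<open>gZ\<close>: if \<open>k = g l g^-1\<close> with
  \<open>l\<close> in \<open>H\<close>, then \<open>k g Z = g l Z = g Z\<close>. So
  \<open>h g Z\<close> depends only on the left coset \<open>hK\<close>, and \<open>K\<close> has
  finite index in \<open>H\<close>.\<close>

lemma commensurated_finite_translates:
  assumes comm: "commensurated G H" and Y: "G_space G Y \<alpha>" and g: "g \<in> carrier G"
    and Z: "Z \<subseteq> topspace Y" "\<And>h. h \<in> H \<Longrightarrow> \<alpha> h ` Z = Z"
  shows "finite ((\<lambda>h. \<alpha> h ` \<alpha> g ` Z) ` H)"
proof -
  interpret group G using Y by (rule G_space_group)
  have H: "subgroup H G" using comm by (simp add: commensurated_def)
  note Hc = subgroup.mem_carrier[OF H]
  define K where "K = H \<inter> (g <#\<^bsub>G\<^esub> H #>\<^bsub>G\<^esub> (inv\<^bsub>G\<^esub> g))"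
  let ?\<R> = "rcosets\<^bsub>G\<lparr>carrier := H\<rparr>\<^esub> K"
  have "finite ?\<R>" using comm g by (simp add: commensurated_def K_def)
  moreover have "(\<lambda>h. \<alpha> h ` \<alpha> g ` Z) ` H \<subseteq> (\<lambda>A. \<alpha> (inv\<^bsub>G\<^esub> (SOME a. a \<in> A)) ` \<alpha> g ` Z) ` ?\<R>"
  proof
    fix C assume "C \<in> (\<lambda>h. \<alpha> h ` \<alpha> g ` Z) ` H"
    then obtain h where h: "h \<in> H" and C: "C = \<alpha> h ` \<alpha> g ` Z" by auto
    \<comment> \<open>The index is counted by right cosets, so \<open>hK\<close> is represented by
      its inverse \<open>K h^-1\<close>. Any representative \<open>a\<close> of it recovers the
      translate as \<open>a^-1 g Z\<close>.\<close>
    define A where "A = K #>\<^bsub>G\<^esub> inv\<^bsub>G\<^esub> h"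
    have hH: "inv\<^bsub>G\<^esub> h \<in> H" using H h by (rule subgroup.m_inv_closed)
    have A: "A \<in> ?\<R>"
      unfolding RCOSETS_def A_def using hH by (auto simp: r_coset_def)
    have "g \<otimes>\<^bsub>G\<^esub> \<one>\<^bsub>G\<^esub> \<otimes>\<^bsub>G\<^esub> inv\<^bsub>G\<^esub> g = \<one>\<^bsub>G\<^esub>" using g by simp
    then have "\<one>\<^bsub>G\<^esub> \<in> K"
      using subgroup.one_closed[OF H] unfolding K_def l_coset_def r_coset_def by force
    then have "\<exists>a. a \<in> A" by (auto simp: A_def r_coset_def)
    then have "(SOME a. a \<in> A) \<in> A" by (rule someI_ex)
    then obtain k where k: "k \<in> K" and a: "(SOME a. a \<in> A) = k \<otimes>\<^bsub>G\<^esub> inv\<^bsub>G\<^esub> h"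
      by (auto simp: A_def r_coset_def)
    \<comment> \<open>With \<open>a = k h^-1\<close> and \<open>k = g l g^-1\<close> one gets
      \<open>a^-1 g = h g l^-1\<close>, and \<open>l^-1\<close> maps \<open>Z\<close> onto
      itself.\<close>
    obtain l where l: "l \<in> H" and kl: "k = g \<otimes>\<^bsub>G\<^esub> l \<otimes>\<^bsub>G\<^esub> inv\<^bsub>G\<^esub> g"
      using k by (auto simp: K_def l_coset_def r_coset_def)
    have il: "inv\<^bsub>G\<^esub> l \<in> H" using H l by (rule subgroup.m_inv_closed)
    note car = g Hc[OF h] Hc[OF l] Hc[OF il]
    have "inv\<^bsub>G\<^esub> (k \<otimes>\<^bsub>G\<^esub> inv\<^bsub>G\<^esub> h) \<otimes>\<^bsub>G\<^esub> g = h \<otimes>\<^bsub>G\<^esub> (g \<otimes>\<^bsub>G\<^esub> inv\<^bsub>G\<^esub> l)"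
      using car by (simp add: kl inv_mult_group m_assoc)
    then have "\<alpha> (inv\<^bsub>G\<^esub> (k \<otimes>\<^bsub>G\<^esub> inv\<^bsub>G\<^esub> h)) ` \<alpha> g ` Z = \<alpha> h ` \<alpha> g ` \<alpha> (inv\<^bsub>G\<^esub> l) ` Z"
      using car Z(1) kl by (simp add: G_space_mult_image[OF Y])
    also have "\<dots> = C" using Z(2)[OF il] C by simp
    finally have "C = \<alpha> (inv\<^bsub>G\<^esub> (SOME a. a \<in> A)) ` \<alpha> g ` Z"
      unfolding a by (rule sym)
    then show "C \<in> (\<lambda>A. \<alpha> (inv\<^bsub>G\<^esub> (SOME a. a \<in> A)) ` \<alpha> g ` Z) ` ?\<R>"
      using A by (rule image_eqI)
  qed
  ultimately show ?thesis by (meson finite_surj)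
qed

text \<open>This is what makes every member of the class an \<open>(H,X)\<close>-boundary, so that
  it can compete in the universal property of the Furstenberg boundary.\<close>

lemma RB_class_subgroup_minimal:
  assumes comm: "commensurated G H"
    and X: "minimal_G_space (G\<lparr>carrier := H\<rparr>) X \<xi>"
    and RB: "RB_class G H X \<xi> Y \<alpha> \<pi>"
  shows "minimal_G_space (G\<lparr>carrier := H\<rparr>) Y \<alpha>"
proof -
  have H: "subgroup H G" using comm by (simp add: commensurated_def)
  have ext: "G_extension G Y \<alpha> X \<xi> \<pi>" and min: "minimal_G_space G Y \<alpha>"
    and sp: "strongly_proximal_extension (G\<lparr>carrier := H\<rparr>) Y \<alpha> X \<xi> \<pi>"
    using RB by (auto simp: RB_class_def)
  have Y: "G_space G Y \<alpha>" and GX: "G_space G X \<xi>"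
    and \<pi>: "continuous_map Y X \<pi>" "equivariant G Y \<alpha> \<xi> \<pi>"
    using ext by (auto simp: G_extension_def)
  interpret group G using Y by (rule G_space_group)
  note Hc = subgroup.mem_carrier[OF H]
  have YH: "G_space (G\<lparr>carrier := H\<rparr>) Y \<alpha>" using Y H by (rule G_space_subgroup)
  have \<pi>H: "equivariant (G\<lparr>carrier := H\<rparr>) Y \<alpha> \<xi> \<pi>"
    using \<pi>(2) Hc by (simp add: equivariant_def)
  obtain x where x: "x \<in> topspace X" using GX unfolding G_space_def by blast
  define \<Z> where "\<Z> = {Z. closedin Y Z \<and> Z \<noteq> {} \<and> (\<forall>h\<in>H. \<alpha> h ` Z = Z)}"
  have sub: "Z \<subseteq> topspace Y" if "Z \<in> \<Z>" for Z
    using that closedin_subset by (auto simp: \<Z>_def)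
  \<comment> \<open>Translating by all of \<open>G\<close> makes the family stable under
    \<open>G\<close>, so that its intersection is \<open>G\<close>-invariant and
    \<open>G\<close>-minimality applies.\<close>
  define \<F> where "\<F> = (\<lambda>(g, Z). \<alpha> g ` Z) ` (carrier G \<times> \<Z>)"
  have \<F>I: "\<alpha> g ` Z \<in> \<F>" if "g \<in> carrier G" "Z \<in> \<Z>" for g Z
    using that unfolding \<F>_def by force
  have \<F>E: thesis
    if "C \<in> \<F>" "\<And>g Z. g \<in> carrier G \<Longrightarrow> Z \<in> \<Z> \<Longrightarrow> C = \<alpha> g ` Z \<Longrightarrow> thesis" for C thesis
    using that unfolding \<F>_def by blast
  have cl: "closedin Y C" if "C \<in> \<F>" for C
    using that G_space_closedin[OF Y] by (auto simp: \<F>_def \<Z>_def)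
  then have sub\<F>: "C \<subseteq> topspace Y" if "C \<in> \<F>" for C
    using that by (simp add: closedin_subset)
  \<comment> \<open>\<open>Z\<close> maps onto \<open>X\<close> by \<open>H\<close>-minimality of
    \<open>X\<close>; its translate does too, because \<open>\<pi>\<close> is equivariant for all of
    \<open>G\<close> and \<open>\<xi> g\<close> is onto.\<close>
  have fib: "\<exists>c\<in>C. \<pi> c = x" if C: "C \<in> \<F>" for C
  proof -
    obtain g Z where g: "g \<in> carrier G" and Z: "Z \<in> \<Z>" and C: "C = \<alpha> g ` Z"
      using C by (rule \<F>E)
    have "\<pi> ` Z = topspace X"
      using Z by (intro equivariant_image_minimal[OF YH X \<pi>(1) \<pi>H]) (auto simp: \<Z>_def)
    moreover have "\<pi> (\<alpha> g z) = \<xi> g (\<pi> z)" if "z \<in> Z" for z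
      using that sub[OF Z] g \<pi>(2) by (auto simp: equivariant_def)
    then have "\<pi> ` C = \<xi> g ` \<pi> ` Z"
      by (simp add: C image_image cong: image_cong)
    ultimately have "\<pi> ` C = \<xi> g ` topspace X" by simp
    also have "\<dots> = topspace X"
      using G_space_action[OF GX] g by (rule group_action.surj_prop)
    finally show ?thesis using x by (metis imageE)
  qed
  have trans: "\<alpha> h ` C \<in> \<F>" if h: "h \<in> carrier G" and C: "C \<in> \<F>" for h C
  proof -
    obtain g Z where g: "g \<in> carrier G" and Z: "Z \<in> \<Z>" and C: "C = \<alpha> g ` Z"
      using C by (rule \<F>E)
    then show ?thesis
      using \<F>I[of "h \<otimes>\<^bsub>G\<^esub> g" Z] h by (simp add: G_space_mult_image[OF Y] sub)
  qed
  have fip: "\<Inter>\<G> \<noteq> {}" if \<G>: "finite \<G>" "\<G> \<subseteq> \<F>" "\<G> \<noteq> {}" for \<G>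
  proof -
    \<comment> \<open>Saturating \<open>\<G>\<close> under \<open>H\<close> gives a family permuted
      by \<open>H\<close>. It stays finite by commensuration and contains \<open>\<G>\<close>
      through the unit.\<close>
    define \<C> where "\<C> = (\<Union>C\<in>\<G>. (\<lambda>h. \<alpha> h ` C) ` H)"
    have CF: "\<C> \<subseteq> \<F>" using \<G> trans Hc by (auto simp: \<C>_def)
    have GC: "\<G> \<subseteq> \<C>"
    proof
      fix C assume C: "C \<in> \<G>"
      then have "C = \<alpha> \<one>\<^bsub>G\<^esub> ` C"
        using \<G>(2) by (intro G_space_one_image[OF Y sub\<F>, symmetric]) auto
      then have "C \<in> (\<lambda>h. \<alpha> h ` C) ` H"
        using subgroup.one_closed[OF H] by (rule image_eqI)
      then show "C \<in> \<C>" unfolding \<C>_def using C by (rule UN_I[rotated])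
    qed
    have "\<Inter>\<C> \<noteq> {}"
    proof (rule strongly_proximal_Inter_nonempty[OF sp x])
      show "finite \<C>"
        unfolding \<C>_def
      proof (rule finite_UN_I[OF \<G>(1)])
        fix C assume "C \<in> \<G>"
        then obtain g Z where "g \<in> carrier G" "Z \<in> \<Z>" "C = \<alpha> g ` Z"
          using \<G>(2) \<F>E by blast
        then show "finite ((\<lambda>h. \<alpha> h ` C) ` H)"
          using commensurated_finite_translates[OF comm Y] sub by (simp add: \<Z>_def)
      qed
      show "\<C> \<noteq> {}" using GC \<G> by auto
      show "closedin Y C" "\<exists>c\<in>C. \<pi> c = x" if "C \<in> \<C>" for C
        using that CF cl fib by auto
      fix h C assume "h \<in> carrier (G\<lparr>carrier := H\<rparr>)" "C \<in> \<C>"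
      then obtain k D where hk: "h \<in> H" "k \<in> H" and D: "D \<in> \<G>" "C = \<alpha> k ` D"
        by (auto simp: \<C>_def)
      have "D \<subseteq> topspace Y" using D(1) \<G>(2) by (intro sub\<F>) auto
      then have "\<alpha> h ` C = \<alpha> (h \<otimes>\<^bsub>G\<^esub> k) ` D"
        using D hk Hc by (simp add: G_space_mult_image[OF Y])
      then show "\<alpha> h ` C \<in> \<C>"
        using D(1) subgroup.m_closed[OF H hk] by (auto simp: \<C>_def)
    qed
    then show ?thesis using GC by blast
  qed
  have top: "topspace Y \<in> \<Z>"
    using Y Hc group_action.surj_prop[OF G_space_action[OF Y]] by (auto simp: \<Z>_def G_space_def)
  \<comment> \<open>A nonempty family keeps its intersection inside the space; the empty one would
    give \<open>UNIV\<close>.\<close>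
  have top\<F>: "topspace Y \<in> \<F>"
    using \<F>I[OF one_closed top] G_space_one_image[OF Y] by simp
  define M where "M = \<Inter>\<F>"
  have "closedin Y M"
    unfolding M_def using cl top\<F> by (intro closedin_Inter) auto
  moreover have "M \<noteq> {}"
  proof -
    have "compact_space Y" using Y by (simp add: G_space_def)
    \<comment> \<open>The empty subfamily, which \<open>fip\<close> excludes, has intersection
      \<open>UNIV\<close>.\<close>
    then show ?thesis
      unfolding M_def compact_space_fip using cl fip top\<F>
      by (metis Inter_empty UNIV_not_empty)
  qed
  moreover have "\<alpha> g ` M \<subseteq> M" if g: "g \<in> carrier G" for g
  proof -
    have "\<alpha> g ` M \<subseteq> C" if C: "C \<in> \<F>" for C
    proof -
      have "M \<subseteq> \<alpha> (inv\<^bsub>G\<^esub> g) ` C" unfolding M_def using trans C g by auto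
      then have "\<alpha> g ` M \<subseteq> \<alpha> g ` \<alpha> (inv\<^bsub>G\<^esub> g) ` C" by (rule image_mono)
      also have "\<dots> = C"
        using g sub\<F>[OF C] by (simp add: G_space_mult_image[OF Y] G_space_one_image[OF Y])
      finally show ?thesis .
    qed
    then show ?thesis by (auto simp: M_def)
  qed
  ultimately have M: "M = topspace Y"
    by (rule minimal_G_spaceD[OF min])
  show ?thesis
  proof (rule minimal_G_spaceI[OF YH])
    fix Z assume Z: "closedin Y Z" "Z \<noteq> {}" "\<And>g. g \<in> carrier (G\<lparr>carrier := H\<rparr>) \<Longrightarrow> \<alpha> g ` Z \<subseteq> Z"
    have "\<alpha> h ` Z = Z" if "h \<in> H" for h
      using that by (intro G_space_invariant_image_eq[OF YH closedin_subset[OF Z(1)] Z(3)]) auto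
    with Z have "Z \<in> \<Z>" by (simp add: \<Z>_def)
    \<comment> \<open>\<open>Z\<close> is its own translate by the unit, so it contains
      \<open>M\<close>, which is the whole space.\<close>
    then have "Z \<in> \<F>"
      using \<F>I[OF one_closed] G_space_one_image[OF Y] sub by metis
    then have "M \<subseteq> Z" by (auto simp: M_def)
    then show "Z = topspace Y" using M closedin_subset[OF Z(1)] by auto
  qed
qed


section \<open>The two universal objects\<close>

text \<open>An action takes values in \<open>Bij\<close>, whose elements are extensional, so
  agreement on \<open>E\<close> is equality of functions. This turns the pointwise agreement of
  \<open>\<beta>\<close> and \<open>\<theta>\<close> on \<open>H\<close> into an equation.\<close>

lemma group_action_eqI:
  assumes "group_action G E \<alpha>" "group_action G' E \<beta>" "g \<in> carrier G" "g \<in> carrier G'"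
    and "\<And>y. y \<in> E \<Longrightarrow> \<alpha> g y = \<beta> g y"
  shows "\<alpha> g = \<beta> g"
  using assms group_action.bij_prop0[OF assms(1,3)] group_action.bij_prop0[OF assms(2,4)]
  by (intro extensionalityI[of _ E]) (auto dest: Bij_imp_extensional)

lemma strongly_proximal_extension_cong:
  assumes sp: "strongly_proximal_extension G Y \<alpha> X \<xi> \<pi>" and Y: "G_space G Y \<beta>"
    and eq: "\<And>g. g \<in> carrier G \<Longrightarrow> \<alpha> g = \<beta> g"
  shows "strongly_proximal_extension G Y \<beta> X \<xi> \<pi>"
proof -
  have "{distr \<nu> (borel_of Y) (\<beta> g) | g. g \<in> carrier G} =
      {distr \<nu> (borel_of Y) (\<alpha> g) | g. g \<in> carrier G}" for \<nu>
    using eq by force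
  then show ?thesis
    using sp Y eq by (simp add: strongly_proximal_extension_def G_extension_def equivariant_def)
qed

lemma minimal_G_space_cong:
  assumes "minimal_G_space G Y \<alpha>" "G_space G Y \<beta>" "\<And>g. g \<in> carrier G \<Longrightarrow> \<alpha> g = \<beta> g"
  shows "minimal_G_space G Y \<beta>"
proof (rule minimal_G_spaceI[OF assms(2)])
  fix Z assume "closedin Y Z" "Z \<noteq> {}" "\<And>g. g \<in> carrier G \<Longrightarrow> \<beta> g ` Z \<subseteq> Z"
  then show "Z = topspace Y"
    using assms(3) by (intro minimal_G_spaceD[OF assms(1)]) auto
qed

text \<open>On \<open>H\<close> the two actions coincide, so \<open>H\<close>-strong proximality
  carries over; minimality passes up from \<open>H\<close> because a \<open>G\<close>-invariant set
  is \<open>H\<close>-invariant.\<close>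

lemma relative_boundary_extension_RB_class:
  assumes H: "subgroup H G" and X: "G_space G X \<xi>"
    and B: "relative_boundary (G\<lparr>carrier := H\<rparr>) X \<xi> B \<theta> \<pi>"
    and ext: "extends_action_over G H \<xi> B \<theta> \<pi> \<beta>"
  shows "RB_class G H X \<xi> B \<beta> \<pi>"
proof -
  have G: "G_space G B \<beta>" and eq0: "\<And>h b. h \<in> H \<Longrightarrow> b \<in> topspace B \<Longrightarrow> \<beta> h b = \<theta> h b"
    and equi: "equivariant G B \<beta> \<xi> \<pi>"
    using ext by (auto simp: extends_action_over_def)
  have min: "minimal_G_space (G\<lparr>carrier := H\<rparr>) B \<theta>"
    and sp: "strongly_proximal_extension (G\<lparr>carrier := H\<rparr>) B \<theta> X \<xi> \<pi>"
    using B by (auto simp: relative_boundary_def)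
  have GH: "G_space (G\<lparr>carrier := H\<rparr>) B \<beta>" using G H by (rule G_space_subgroup)
  have "group_action (G\<lparr>carrier := H\<rparr>) (topspace B) \<theta>"
    using min by (simp add: minimal_G_space_def G_space_def)
  from group_action_eqI[OF this G_space_action[OF GH]]
  have eq: "\<theta> h = \<beta> h" if "h \<in> carrier (G\<lparr>carrier := H\<rparr>)" for h
    using that eq0 by simp
  have "minimal_G_space (G\<lparr>carrier := H\<rparr>) B \<beta>"
    using min GH eq by (rule minimal_G_space_cong)
  then have "minimal_G_space G B \<beta>"
    using G subgroup.subset[OF H] by (rule minimal_G_space_supergroup)
  moreover have "G_extension G B \<beta> X \<xi> \<pi>"
    using G X equi sp by (simp add: G_extension_def strongly_proximal_extension_def)
  moreover have "strongly_proximal_extension (G\<lparr>carrier := H\<rparr>) B \<beta> X \<xi> \<pi>"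
    using sp GH eq by (rule strongly_proximal_extension_cong)
  ultimately show ?thesis by (simp add: RB_class_def)
qed

lemma furstenberg_boundaryD:
  fixes B Y :: "'u topology"
  assumes "furstenberg_boundary G X \<xi> B \<beta> \<pi>B" "relative_boundary G X \<xi> Y \<alpha> \<pi>"
  shows "\<exists>!\<Phi>. \<Phi> \<in> extensional (topspace B) \<and>
    continuous_map B Y \<Phi> \<and> \<Phi> ` topspace B = topspace Y \<and> equivariant G B \<beta> \<alpha> \<Phi> \<and>
    (\<forall>b \<in> topspace B. \<pi> (\<Phi> b) = \<pi>B b)"
  by (rule conjunct2[OF assms(1)[unfolded furstenberg_boundary_def], rule_format, OF assms(2)])

text \<open>The boundary competes against itself: \<open>f\<close> and the identity both satisfy the
  universal property, so uniqueness identifies them.\<close>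

lemma furstenberg_boundary_endomorphism:
  assumes fb: "furstenberg_boundary G X \<xi> B \<theta> \<pi>"
    and f: "continuous_map B B f" "equivariant G B \<theta> \<theta> f" "\<And>b. b \<in> topspace B \<Longrightarrow> \<pi> (f b) = \<pi> b"
    and b: "b \<in> topspace B"
  shows "f b = b"
proof -
  have rb: "relative_boundary G X \<xi> B \<theta> \<pi>"
    using fb by (simp add: furstenberg_boundary_def)
  have uni: "\<exists>!\<Phi>. \<Phi> \<in> extensional (topspace B) \<and> continuous_map B B \<Phi> \<and>
      \<Phi> ` topspace B = topspace B \<and> equivariant G B \<theta> \<theta> \<Phi> \<and> (\<forall>b \<in> topspace B. \<pi> (\<Phi> b) = \<pi> b)"
      (is "\<exists>!\<Phi>. ?P \<Phi>")
    by (rule furstenberg_boundaryD[OF fb rb])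
  have min: "minimal_G_space G B \<theta>" using rb by (simp add: relative_boundary_def)
  then have G: "G_space G B \<theta>" by (simp add: minimal_G_space_def)
  have img: "\<theta> g ` topspace B = topspace B" if "g \<in> carrier G" for g
    using G_space_action[OF G] that by (rule group_action.surj_prop)
  then have mem: "\<theta> g b \<in> topspace B" if "g \<in> carrier G" "b \<in> topspace B" for g b
    using that by blast
  \<comment> \<open>Surjectivity belongs to the uniqueness clause; for \<open>f\<close> it follows
    from minimality.\<close>
  have surj: "f ` topspace B = topspace B"
    using G min f(1,2)
  proof (rule equivariant_image_minimal)
    show "topspace B \<noteq> {}" using b by auto
  qed (use img in auto)
  \<comment> \<open>Uniqueness holds among extensional maps, so both candidates are restricted to
    the space.\<close>
  have "?P (restrict f (topspace B))"
    using f mem surj by (auto simp: equivariant_def continuous_map_eq[OF f(1)])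
  moreover have "?P (restrict (\<lambda>b. b) (topspace B))"
    using mem by (auto simp: equivariant_def continuous_map_eq[OF continuous_map_id])
  ultimately have "restrict f (topspace B) = restrict (\<lambda>b. b) (topspace B)"
    using uni by blast
  then show ?thesis using b by (metis restrict_apply')
qed

theorem theorem4p16:
  fixes \<Gamma> :: "('g, 'm) monoid_scheme" and H :: "'g set"
    and X :: "'x topology" and \<xi> :: "'g \<Rightarrow> 'x \<Rightarrow> 'x"
    and R :: "'u topology" and \<rho> :: "'g \<Rightarrow> 'u \<Rightarrow> 'u" and \<pi>RB :: "'u \<Rightarrow> 'x"
    and B :: "'u topology" and \<theta> :: "'g \<Rightarrow> 'u \<Rightarrow> 'u" and \<pi>H :: "'u \<Rightarrow> 'x"
    and \<beta> :: "'g \<Rightarrow> 'u \<Rightarrow> 'u"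
  assumes "group \<Gamma>"
    and "commensurated \<Gamma> H"
    and "G_space \<Gamma> X \<xi>"
    and "minimal_G_space (\<Gamma>\<lparr>carrier := H\<rparr>) X \<xi>"
    and "RB_universal \<Gamma> H X \<xi> R \<rho> \<pi>RB"
    and "furstenberg_boundary (\<Gamma>\<lparr>carrier := H\<rparr>) X \<xi> B \<theta> \<pi>H"
    and "extends_action_over \<Gamma> H \<xi> B \<theta> \<pi>H \<beta>"
  shows "\<exists>f. homeomorphic_map R B f \<and> equivariant \<Gamma> R \<rho> \<beta> f"
proof -
  let ?H = "\<Gamma>\<lparr>carrier := H\<rparr>"
  have H: "subgroup H \<Gamma>" using assms(2) by (simp add: commensurated_def)
  have rbB: "relative_boundary ?H X \<xi> B \<theta> \<pi>H"
    using assms(6) by (simp add: furstenberg_boundary_def)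
  have RBR: "RB_class \<Gamma> H X \<xi> R \<rho> \<pi>RB"
    using assms(5) by (simp add: RB_universal_def)
  have RBB: "RB_class \<Gamma> H X \<xi> B \<beta> \<pi>H"
    using H assms(3) rbB assms(7) by (rule relative_boundary_extension_RB_class)
  then obtain f where f: "continuous_map R B f" "equivariant \<Gamma> R \<rho> \<beta> f"
    "\<And>r. r \<in> topspace R \<Longrightarrow> \<pi>H (f r) = \<pi>RB r"
    using assms(5) unfolding RB_universal_def by blast
  have minR: "minimal_G_space ?H R \<rho>"
    using assms(2,4) RBR by (rule RB_class_subgroup_minimal)
  then have "relative_boundary ?H X \<xi> R \<rho> \<pi>RB"
    using RBR by (simp add: relative_boundary_def RB_class_def)
  from ex1_implies_ex[OF furstenberg_boundaryD[OF assms(6) this]]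
  obtain \<Phi> where \<Phi>: "continuous_map B R \<Phi>" "\<Phi> ` topspace B = topspace R"
    "equivariant ?H B \<theta> \<rho> \<Phi>" "\<And>b. b \<in> topspace B \<Longrightarrow> \<pi>RB (\<Phi> b) = \<pi>H b"
    by blast
  have fm: "f r \<in> topspace B" if "r \<in> topspace R" for r
    using that continuous_map_funspace[OF f(1)] by auto
  have \<Phi>m: "\<Phi> b \<in> topspace R" if "b \<in> topspace B" for b
    using that \<Phi>(2) by auto
  \<comment> \<open>The composite is an \<open>H\<close>-equivariant self-map of \<open>B\<close>
    over \<open>X\<close>: \<open>f\<close> is equivariant for \<open>\<beta>\<close>, which agrees
    with \<open>\<theta>\<close> on \<open>H\<close>.\<close>
  have inv: "f (\<Phi> b) = b" if "b \<in> topspace B" for b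
  proof -
    have "(f \<circ> \<Phi>) b = b"
      using assms(6)
    proof (rule furstenberg_boundary_endomorphism)
      show "continuous_map B B (f \<circ> \<Phi>)" using \<Phi>(1) f(1) by (rule continuous_map_compose)
      show "equivariant ?H B \<theta> \<theta> (f \<circ> \<Phi>)"
        using f(2) \<Phi>(3) \<Phi>m fm assms(7) subgroup.mem_carrier[OF H]
        by (auto simp: equivariant_def extends_action_over_def)
      show "\<pi>H ((f \<circ> \<Phi>) b) = \<pi>H b" if "b \<in> topspace B" for b
        using that f(3) \<Phi>(4) \<Phi>m by simp
    qed (rule that)
    then show ?thesis by simp
  qed
  have "homeomorphic_map R B f"
  proof (rule continuous_imp_homeomorphic_map[OF f(1)])
    show "compact_space R" using minR by (simp add: minimal_G_space_def G_space_def)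
    show "Hausdorff_space B"
      using rbB by (simp add: relative_boundary_def minimal_G_space_def G_space_def)
    show "f ` topspace R = topspace B"
      using fm \<Phi>m inv by (force simp: image_iff)
    \<comment> \<open>The universal property of \<open>R\<close> asserts existence only, so
      injectivity comes from \<open>\<Phi>\<close> being onto: each point of \<open>R\<close> is
      some \<open>\<Phi> b\<close>, and \<open>f\<close> recovers \<open>b\<close>.\<close>
    show "inj_on f (topspace R)"
      using inv \<Phi>(2) by (metis (no_types, lifting) imageE inj_onI)
  qed
  with f(2) show ?thesis by blast
qed

end
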